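(* Let $0<p\le 1$, let $(X,\|\cdot\|)$ be a real Banach space, $\mathcal D\subset X$ a radial dictionary, and $\mathcal E:X\to\mathbb R$ a Fréchet differentiable functional. Assume that for each bounded set $K\subset X$ there is a constant $\mathcal L_K>0$ such that $\|\mathcal E'(u)-\mathcal E'(w)\|_*\le\mathcal L_K\|u-w\|^p$ for all $u,w\in K$. For $r>0$ set $M_r:=1+\sup_{x\in B_r}\|\mathcal E'(x)\|_*$. Then the following hold. (a) For every $x\in B_r$, $$\min_{z\in\mathcal D}\mathcal E(x+z)\le\mathcal E(x)-\beta_r\,\bigl(\sigma(x)\bigr)^{1+\frac1p},$$ where $$\sigma(x):=\sup_{w\in\mathcal D\cap S_X}|\langle\mathcal E'(x),w\rangle|,\qquad \beta_r:=\frac{p}{p+1}\min\left\{\frac{r}{M_r^{1/p}},\frac{1}{\mathcal L_{B_{2r}}^{1/p}}\right\}.$$ (b) If there is $\mathcal L>0$ such that $\|\mathcal E'(u)-\mathcal E'(w)\|_*\le\mathcal L\|u-w\|^p$ for all $u,w\in X$, then the conclusion of (a) holds for all $x\in X$ (with no restriction to $B_r$) provided that $\beta_r$ is replaced by $\beta:=\frac{p}{(p+1)\,\mathcal L^{1/p}}$; that is, for all $x\in X$, $$\min_{z\in\mathcal D}\mathcal E(x+z)\le\mathcal E(x)-\beta\,\bigl(\sigma(x)\bigr)^{1+\frac1p}.$$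
   Context: $S_X=\{x\in X:\|x\|=1\}$ is the unit sphere and $B_r$ is the closed ball of radius $r$ centered at $0$; $\|\cdot\|_*$ is the norm of the dual space $X^*$ and $\langle\cdot,\cdot\rangle$ the duality pairing. $\mathcal L_{B_{2r}}$ is the constant $\mathcal L_K$ for $K=B_{2r}$. A set $C\subset X$ is a cone if $\lambda x\in C$ for all $x\in C$, $\lambda\ge 0$; it is balanced if $C=-C$. A radial dictionary is a weakly closed (possibly non-convex) balanced cone $\mathcal D\subset X$.
   Formalization: The minimum over the dictionary is read as an infimum, possibly minus infinity, because it need not be attained (X = D = the real line, E(x) = x); the dictionary is taken nonempty, and sigma(x) is 0 if it has no unit vectors. *)

theory Defs
  imports "HOL-Analysis.Analysis"
begin

text \<open>The dual space of \<^typ>\<open>'a\<close> is the type \<^typ>\<open>'a \<Rightarrow>\<^sub>L real\<close>, whose norm is the operator norm.\<close>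

definition weak_topology :: "'a::real_normed_vector topology" where
  "weak_topology =
     topology_generated_by {blinfun_apply f -` U | (f :: 'a \<Rightarrow>\<^sub>L real) U. open U}"

text \<open>The condition \<^term>\<open>D \<noteq> {}\<close> excludes the empty set, which satisfies the other
  three conditions vacuously. Together with \<^term>\<open>cone D\<close> it gives \<^term>\<open>0 \<in> D\<close>.\<close>

definition radial_dictionary :: "'a::real_normed_vector set \<Rightarrow> bool" where
  "radial_dictionary D \<longleftrightarrow>
     D \<noteq> {} \<and> cone D \<and> D = uminus ` D \<and> closedin weak_topology D"

definition holder_on ::
  "('a::real_normed_vector \<Rightarrow> ('a \<Rightarrow>\<^sub>L real)) \<Rightarrow> real \<Rightarrow> real \<Rightarrow> 'a set \<Rightarrow> bool" where
  "holder_on E' p L K \<longleftrightarrow>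
     (\<forall>u\<in>K. \<forall>w\<in>K. norm (E' u - E' w) \<le> L * norm (u - w) powr p)"

definition M_const :: "('a::real_normed_vector \<Rightarrow> ('a \<Rightarrow>\<^sub>L real)) \<Rightarrow> real \<Rightarrow> real" where
  "M_const E' r = 1 + (SUP x\<in>cball 0 r. norm (E' x))"

text \<open>For the dictionary \<open>{0}\<close> the set of unit directions is empty. The supremum is
  then 0, as for a set of nonnegative numbers; the library leaves the supremum of the
  empty set of reals unspecified.\<close>

definition dict_sigma ::
  "'a::real_normed_vector set \<Rightarrow> ('a \<Rightarrow> ('a \<Rightarrow>\<^sub>L real)) \<Rightarrow> 'a \<Rightarrow> real" where
  "dict_sigma D E' x =
     (if D \<inter> sphere 0 1 = {} then 0
      else (SUP w\<in>D \<inter> sphere 0 1. \<bar>blinfun_apply (E' x) w\<bar>))"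

text \<open>The argument \<open>LK\<close> assigns to each bounded set its Hoelder constant.\<close>

definition beta_r ::
  "real \<Rightarrow> ('a::real_normed_vector \<Rightarrow> ('a \<Rightarrow>\<^sub>L real)) \<Rightarrow> ('a set \<Rightarrow> real) \<Rightarrow> real \<Rightarrow> real" where
  "beta_r p E' LK r =
     p / (p + 1) *
       min (r / M_const E' r powr (1 / p)) (1 / LK (cball 0 (2 * r)) powr (1 / p))"

text \<open>The minimum over the dictionary, as an infimum in the extended reals. A minimum
  need not exist under the hypotheses: for a nonzero bounded linear \<open>E\<close> on the real line with
  \<^term>\<open>D = UNIV\<close> the value is \<^term>\<open>-\<infinity>\<close>. Where a minimum exists, the infimum is its value.\<close>

definition dict_min :: "'a::real_normed_vector set \<Rightarrow> ('a \<Rightarrow> real) \<Rightarrow> 'a \<Rightarrow> ereal" where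
  "dict_min D E x = (INF z\<in>D. ereal (E (x + z)))"

end

theory Submission
  imports Defs
begin

text \<open>Integrating the Hoelder bound along a direction \<open>w\<close> of the dictionary gives
  \<open>E (x + t w) \<le> E x - t a + L t\<^sup>1\<^sup>+\<^sup>p / (1 + p)\<close>, where the sign of \<open>w\<close> is chosen such that
  \<open>E' x w = - a \<le> 0\<close>. The step \<open>t = c a\<^sup>1\<^sup>/\<^sup>p\<close> with \<open>L c\<^sup>p \<le> 1\<close> decreases the energy by at least
  \<open>p / (p + 1) c a\<^sup>1\<^sup>+\<^sup>1\<^sup>/\<^sup>p\<close>. In part (a) the constant \<open>c \<le> r / M\<^sub>r\<^sup>1\<^sup>/\<^sup>p\<close> also keeps \<open>x + t w\<close> inside
  the ball of radius \<open>2 r\<close>. No direction need attain the supremum, so the estimate is proved for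
  every direction and then passed to the supremum.\<close>

text \<open>No integral is formed. The auxiliary function \<open>g\<close>, which is the energy
  along the segment minus its linear part and the Hoelder remainder, has nonpositive derivative by
  the Hoelder bound between \<open>x + s *\<^sub>R w\<close> and \<open>x\<close>; comparing
  \<open>g t\<close> with \<open>g 0\<close> gives the claim.\<close>

lemma holder_descent:
  fixes E :: "'a::real_normed_vector \<Rightarrow> real"
  assumes p: "0 < p" and L: "0 \<le> L" and t: "0 \<le> t"
    and deriv: "\<And>x. (E has_derivative blinfun_apply (E' x)) (at x)"
    and holder: "holder_on E' p L K"
    and segment: "\<And>s. 0 \<le> s \<Longrightarrow> s \<le> t \<Longrightarrow> x + s *\<^sub>R w \<in> K"
    and w: "norm w = 1"
  shows "E (x + t *\<^sub>R w) \<le> E x + t * E' x w + L * t powr (p + 1) / (p + 1)"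
proof -
  define g where "g s = E (x + s *\<^sub>R w) - s * E' x w - L * s powr (p + 1) / (p + 1)" for s
  have dE: "((\<lambda>s. E (x + s *\<^sub>R w)) has_real_derivative E' (x + s *\<^sub>R w) w) (at s)" for s
  proof -
    have line: "((\<lambda>s. x + s *\<^sub>R w) has_derivative (\<lambda>h. h *\<^sub>R w)) (at s)"
      by (auto intro!: derivative_eq_intros)
    show ?thesis
      using has_derivative_compose[OF line deriv]
      by (simp add: has_field_derivative_def blinfun.scaleR_right mult.commute[of _ "E' _ w"])
  qed
  have "g t \<le> g 0"
  proof (rule DERIV_nonpos_imp_decreasing_open[OF t])
    \<comment> \<open>Differentiating only at interior points keeps the base of
      \<open>s powr (p + 1)\<close> positive; at the endpoints continuity suffices.\<close>
    fix s assume s: "0 < s" "s < t"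
    have "(g has_real_derivative E' (x + s *\<^sub>R w) w - E' x w - L * s powr p) (at s)"
      unfolding g_def using s p
      by (auto intro!: derivative_eq_intros dE simp: divide_simps) (simp add: algebra_simps)
    moreover have "E' (x + s *\<^sub>R w) w - E' x w \<le> L * s powr p"
    proof -
      have "E' (x + s *\<^sub>R w) w - E' x w = (E' (x + s *\<^sub>R w) - E' x) w"
        by (simp add: blinfun.diff_left)
      also have "\<dots> \<le> norm (E' (x + s *\<^sub>R w) - E' x)"
        using norm_blinfun[of "E' (x + s *\<^sub>R w) - E' x" w] w by simp
      also have "\<dots> \<le> L * norm (x + s *\<^sub>R w - x) powr p"
        using holder segment[of s] segment[of 0] s t unfolding holder_on_def
        by (metis add.right_neutral less_imp_le order_refl scaleR_zero_left)
      finally show ?thesis using s w by simp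
    qed
    ultimately show "\<exists>y. (g has_real_derivative y) (at s) \<and> y \<le> 0"
      by (intro exI conjI) auto
  next
    have "continuous_on {0..t} (\<lambda>s. E (x + s *\<^sub>R w))"
      using DERIV_isCont[OF dE] by (blast intro: continuous_at_imp_continuous_on)
    then show "continuous_on {0..t} g"
      unfolding g_def using p by (auto intro!: continuous_intros continuous_on_powr')
  qed
  then show ?thesis using p by (simp add: g_def)
qed

text \<open>The step length makes \<open>L * t powr p \<le> a\<close>, so the remainder is at most
  \<open>t * a / (p + 1)\<close> and the fraction \<open>p / (p + 1)\<close> of the linear gain
  \<open>t * a\<close> survives. Since \<open>a \<le> norm (E' x)\<close>, the hypothesis
  \<open>ball\<close> puts the whole segment into \<open>K\<close>.\<close>

lemma holder_step_descent:
  fixes E :: "'a::real_normed_vector \<Rightarrow> real"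
  assumes p: "0 < p" and L: "0 \<le> L" and c: "0 \<le> c" and Lc: "L * c powr p \<le> 1"
    and deriv: "\<And>x. (E has_derivative blinfun_apply (E' x)) (at x)"
    and holder: "holder_on E' p L K"
    and ball: "\<And>z. norm z \<le> c * norm (E' x) powr (1 / p) \<Longrightarrow> x + z \<in> K"
    and w: "norm w = 1" and descent: "E' x w = - a" "0 \<le> a"
  shows "E (x + (c * a powr (1 / p)) *\<^sub>R w) \<le> E x - p / (p + 1) * c * a powr (1 + 1 / p)"
proof -
  define t where "t = c * a powr (1 / p)"
  have t: "0 \<le> t" using c by (simp add: t_def)
  have "a \<le> norm (E' x)" using norm_blinfun[of "E' x" w] w descent by simp
  then have t_le: "t \<le> c * norm (E' x) powr (1 / p)"
    unfolding t_def using c p descent by (intro mult_left_mono powr_mono2) auto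
  have "E (x + t *\<^sub>R w) \<le> E x + t * E' x w + L * t powr (p + 1) / (p + 1)"
    using t t_le w by (intro holder_descent[OF p L t deriv holder _ w] ball) auto
  moreover have "L * t powr (p + 1) \<le> t * a"
  proof -
    have "L * t powr p = (L * c powr p) * a"
      using c p descent by (simp add: t_def powr_mult powr_powr)
    also have "\<dots> \<le> a" using mult_right_mono[OF Lc descent(2)] by simp
    finally have "t * (L * t powr p) \<le> t * a" using t by (rule mult_left_mono)
    then show ?thesis using t by (cases "t = 0") (auto simp: powr_add mult_ac)
  qed
  then have "L * t powr (p + 1) / (p + 1) \<le> t * a / (p + 1)"
    using p by (intro divide_right_mono) auto
  ultimately have "E (x + t *\<^sub>R w) \<le> E x - t * a + t * a / (p + 1)"
    using descent by simp
  also have "\<dots> = E x - p / (p + 1) * (t * a)"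
    using p by (simp add: divide_simps) (simp add: algebra_simps)
  also have "t * a = c * a powr (1 + 1 / p)"
    using descent(2) by (cases "a = 0") (auto simp: t_def powr_add)
  finally show ?thesis by (simp add: t_def)
qed

lemma zero_in_radial_dictionary:
  assumes "radial_dictionary D"
  shows "0 \<in> D"
  using assms unfolding radial_dictionary_def cone_def by (metis equals0I order_refl scaleR_zero_left)

lemma cone_scaleR_mem: "cone D \<Longrightarrow> w \<in> D \<Longrightarrow> 0 \<le> t \<Longrightarrow> t *\<^sub>R w \<in> D" for t :: real
  unfolding cone_def by blast

text \<open>Common core of both parts: \<open>K\<close> is the ball of radius \<open>2 * r\<close>
  in part (a) and the whole space in part (b), and only \<open>c\<close> changes with it.\<close>

lemma dict_min_le_sigma:
  fixes E :: "'a::real_normed_vector \<Rightarrow> real"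
  assumes p: "0 < p" and L: "0 \<le> L" and c: "0 < c" and Lc: "L * c powr p \<le> 1"
    and D: "radial_dictionary D"
    and deriv: "\<And>x. (E has_derivative blinfun_apply (E' x)) (at x)"
    and holder: "holder_on E' p L K"
    and ball: "\<And>z. norm z \<le> c * norm (E' x) powr (1 / p) \<Longrightarrow> x + z \<in> K"
  shows "dict_min D E x \<le> ereal (E x - p / (p + 1) * c * dict_sigma D E' x powr (1 + 1 / p))"
proof -
  define \<kappa> q where "\<kappa> = p / (p + 1) * c" and "q = 1 + 1 / p"
  have pos: "0 < \<kappa>" "0 < q" using p c by (simp_all add: \<kappa>_def q_def add_pos_pos)
  have step: "dict_min D E x \<le> ereal (E x - \<kappa> * \<bar>E' x w\<bar> powr q)"
    if w: "w \<in> D" "norm w = 1" for w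
  proof -
    define v where "v = (if E' x w \<le> 0 then w else - w)"
    have "- w \<in> D" using D w unfolding radial_dictionary_def by blast
    with w have v: "v \<in> D" "norm v = 1" "E' x v = - \<bar>E' x w\<bar>"
      by (auto simp: v_def blinfun.minus_right)
    define z where "z = (c * \<bar>E' x w\<bar> powr (1 / p)) *\<^sub>R v"
    have "z \<in> D"
      unfolding z_def using D v c by (auto simp: radial_dictionary_def intro!: cone_scaleR_mem)
    then have "dict_min D E x \<le> ereal (E (x + z))"
      unfolding dict_min_def by (rule INF_lower)
    also have "\<dots> \<le> ereal (E x - \<kappa> * \<bar>E' x w\<bar> powr q)"
      using holder_step_descent[OF p L less_imp_le[OF c] Lc deriv holder ball v(2,3)]
      by (simp add: z_def \<kappa>_def q_def)
    finally show ?thesis .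
  qed
  show ?thesis
  proof (cases "D \<inter> sphere 0 1 = {}")
    case True
    \<comment> \<open>Here the claimed gain is zero, because \<open>0 powr (1 + 1 / p) = 0\<close>,
      so the trivial choice \<open>0\<close> in \<open>D\<close> is enough.\<close>
    have "dict_min D E x \<le> ereal (E (x + 0))"
      unfolding dict_min_def using zero_in_radial_dictionary[OF D] by (rule INF_lower)
    then show ?thesis using True by (simp add: dict_sigma_def)
  next
    case False
    define \<sigma> where "\<sigma> = (SUP w\<in>D \<inter> sphere 0 1. \<bar>E' x w\<bar>)"
    have \<sigma>: "dict_sigma D E' x = \<sigma>" using False by (simp add: dict_sigma_def \<sigma>_def)
    show ?thesis
    proof (cases "dict_min D E x")
      case (real m)
      \<comment> \<open>Solving \<open>step\<close> for the slope bounds every direction by the same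
        number \<open>d powr (1 / q)\<close>. The supremum inherits this bound, with no appeal to
        continuity of the power, and raising to the power \<open>q\<close> undoes the root.\<close>
      define d where "d = (E x - m) / \<kappa>"
      have bound: "\<bar>E' x w\<bar> powr q \<le> d" if "w \<in> D \<inter> sphere 0 1" for w
        using step[of w] that real pos by (simp add: d_def field_simps)
      have le_root: "\<bar>E' x w\<bar> \<le> d powr (1 / q)" if "w \<in> D \<inter> sphere 0 1" for w
        using powr_mono2[OF _ _ bound[OF that], of "1 / q"] pos by (simp add: powr_powr)
      have "\<sigma> \<le> d powr (1 / q)"
        unfolding \<sigma>_def by (rule cSUP_least[OF False le_root])
      moreover obtain w where w: "w \<in> D \<inter> sphere 0 1" using False by blast
      then have "\<bar>E' x w\<bar> \<le> \<sigma>"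
        unfolding \<sigma>_def by (rule cSUP_upper) (auto intro!: bdd_aboveI2 le_root)
      then have "0 \<le> \<sigma>" by simp
      ultimately have "\<sigma> powr q \<le> (d powr (1 / q)) powr q"
        using pos by (intro powr_mono2) auto
      \<comment> \<open>The root and the power cancel only for nonnegative \<open>d\<close>; any one
        unit direction shows this, since \<open>d\<close> dominates a power.\<close>
      also have "\<dots> = d"
        using pos order_trans[OF powr_ge_zero bound[OF w]] by (simp add: powr_powr)
      finally have "\<kappa> * \<sigma> powr q \<le> E x - m" using pos by (simp add: d_def field_simps)
      then show ?thesis using real \<sigma> by (simp add: \<kappa>_def q_def)
    next
      case PInf
      with step False show ?thesis by auto
    next
      case MInf
      then show ?thesis by simp
    qed
  qed
qed

text \<open>Ensures that the supremum in \<open>M_const\<close> is a genuine one: comparison with a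
  fixed point of \<open>K\<close> bounds the derivative by the diameter.\<close>

lemma holder_on_bounded_bdd_above:
  assumes p: "0 \<le> p" and L: "0 \<le> L" and holder: "holder_on E' p L K" and K: "bounded K"
  shows "bdd_above ((\<lambda>x. norm (E' x)) ` K)"
proof (cases "K = {}")
  case False
  then obtain y where y: "y \<in> K" by blast
  obtain B where B: "\<And>x. x \<in> K \<Longrightarrow> norm (x - y) \<le> B"
    using K by (metis bounded_any_center dist_commute dist_norm)
  show ?thesis
  proof (rule bdd_aboveI2)
    fix x assume x: "x \<in> K"
    have "norm (E' x) \<le> norm (E' y) + norm (E' x - E' y)"
      by (metis norm_triangle_sub)
    also have "norm (E' x - E' y) \<le> L * norm (x - y) powr p"
      using holder x y by (auto simp: holder_on_def)
    also have "\<dots> \<le> L * B powr p"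
      using p L B[OF x] by (intro mult_left_mono powr_mono2) auto
    finally show "norm (E' x) \<le> norm (E' y) + L * B powr p" by simp
  qed
qed simp

lemma norm_less_M_const:
  assumes "bdd_above ((\<lambda>x. norm (E' x)) ` cball 0 r)" and "x \<in> cball 0 r"
  shows "norm (E' x) < M_const E' r"
  unfolding M_const_def using cSUP_upper[OF assms(2,1)] by simp

theorem proposition3p1:
  fixes p :: real
    and D :: "'a::banach set"
    and E :: "'a \<Rightarrow> real"
    and E' :: "'a \<Rightarrow> ('a \<Rightarrow>\<^sub>L real)"
    and LK :: "'a set \<Rightarrow> real"
  assumes "0 < p" and "p \<le> 1"
    and "radial_dictionary D"
    and "\<And>x. (E has_derivative blinfun_apply (E' x)) (at x)"
    and "\<And>K. bounded K \<Longrightarrow> LK K > 0 \<and> holder_on E' p (LK K) K"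
  shows "(\<forall>r>0. \<forall>x\<in>cball 0 r.
            dict_min D E x \<le> ereal (E x - beta_r p E' LK r * dict_sigma D E' x powr (1 + 1 / p)))
       \<and> (\<forall>L>0. holder_on E' p L UNIV \<longrightarrow>
            (\<forall>x. dict_min D E x
               \<le> ereal (E x - p / ((p + 1) * L powr (1 / p)) * dict_sigma D E' x powr (1 + 1 / p))))"
proof (intro conjI allI ballI impI)
  note p = assms(1) and D = assms(3) and deriv = assms(4) and LK = assms(5)
  fix r :: real and x :: 'a assume r: "0 < r" and x: "x \<in> cball 0 r"
  define L M where "L = LK (cball 0 (2 * r))" and "M = M_const E' r"
  \<comment> \<open>Chosen so that \<open>beta_r\<close> equals \<open>p / (p + 1) * c\<close>. The
    second entry yields \<open>Lc\<close>; the first limits the displacement to \<open>r\<close>,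
    hence the ball of radius \<open>2 * r\<close>.\<close>
  define c where "c = min (r / M powr (1 / p)) (1 / L powr (1 / p))"
  have L: "0 < L" and holder: "holder_on E' p L (cball 0 (2 * r))"
    using LK[of "cball 0 (2 * r)"] by (simp_all add: L_def)
  have M: "norm (E' x) < M"
    unfolding M_def using LK[of "cball 0 r"] p x
    by (intro norm_less_M_const holder_on_bounded_bdd_above[where p = p and L = "LK (cball 0 r)"]) auto
  \<comment> \<open>The summand 1 in \<open>M_const\<close> makes the bound strict, so
    \<open>M\<close> is positive even where the derivative vanishes.\<close>
  then have "0 < M" by (rule le_less_trans[OF norm_ge_zero])
  then have c: "0 < c" using r L by (simp add: c_def)
  have "c powr p \<le> (1 / L powr (1 / p)) powr p"
    using c p by (intro powr_mono2) (auto simp: c_def)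
  also have "\<dots> = 1 / L" using L p by (simp add: powr_divide powr_powr)
  finally have Lc: "L * c powr p \<le> 1" using L by (simp add: field_simps)
  have "c * norm (E' x) powr (1 / p) \<le> r / M powr (1 / p) * M powr (1 / p)"
    using c p M r by (intro mult_mono powr_mono2) (auto simp: c_def)
  also have "\<dots> = r" using \<open>0 < M\<close> by simp
  finally have "x + z \<in> cball 0 (2 * r)" if "norm z \<le> c * norm (E' x) powr (1 / p)" for z
    using that x norm_triangle_ineq[of x z] by simp
  from dict_min_le_sigma[OF p less_imp_le[OF L] c Lc D deriv holder this]
  show "dict_min D E x \<le> ereal (E x - beta_r p E' LK r * dict_sigma D E' x powr (1 + 1 / p))"
    by (simp add: beta_r_def c_def L_def M_def)
next
  note p = assms(1) and D = assms(3) and deriv = assms(4)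
  fix L :: real and x :: 'a assume L: "0 < L" and holder: "holder_on E' p L UNIV"
  \<comment> \<open>With \<open>K = UNIV\<close> the displacement is unrestricted, so
    \<open>c\<close> can be taken with \<open>L * c powr p = 1\<close>.\<close>
  define c where "c = 1 / L powr (1 / p)"
  have c: "0 < c" using L by (simp add: c_def)
  have Lc: "L * c powr p \<le> 1" using L p by (simp add: c_def powr_divide powr_powr)
  show "dict_min D E x
      \<le> ereal (E x - p / ((p + 1) * L powr (1 / p)) * dict_sigma D E' x powr (1 + 1 / p))"
    using dict_min_le_sigma[OF p less_imp_le[OF L] c Lc D deriv holder UNIV_I]
    by (simp add: c_def)
qed

end
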